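(* Let $V$ be a complex Hilbert space. If $x,y\in V$ then $$[\pi(x),\pi(y)]=i\,\Omega(x,y)\,I,$$ both as operators on $SV$ and as operators on $SV'$.
   Context: $V$ has inner product $\langle\cdot|\cdot\rangle$ (antilinear in the first slot, linear in the second), and $\Omega=\mathrm{Im}\langle\cdot|\cdot\rangle$. $SV$ is the (algebraic) symmetric algebra of $V$ and $SV'$ is the space of all antilinear functionals $SV\to\mathbb C$ (no boundedness required). For $v\in V$, $c(v):SV\to SV$ is multiplication by $v$, and $a(v):SV\to SV$ is the unique linear derivation with $a(v)1=0$ and $a(v)w=\langle v|w\rangle$ for $w\in V$. They extend to $SV'$ by $[c(v)\Phi](\psi)=\Phi(a(v)\psi)$ and $[a(v)\Phi](\psi)=\Phi(c(v)\psi)$ for $\Phi\in SV'$, $\psi\in SV$. On $SV$ and on $SV'$ put $\pi(v)=\frac1{\sqrt2}\{c(v)+a(v)\}$. $[A,B]=AB-BA$. *)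

theory Defs
  imports Complex_Main "HOL-Library.Poly_Mapping" "HOL-Library.Multiset"
begin

section \<open>Complex Hilbert spaces\<close>

class complex_vector = ab_group_add +
  fixes scaleC :: "complex \<Rightarrow> 'a \<Rightarrow> 'a"  (infixr "*\<^sub>C" 75)
  assumes scaleC_add_right: "z *\<^sub>C (x + y) = z *\<^sub>C x + z *\<^sub>C y"
    and scaleC_add_left: "(z + w) *\<^sub>C x = z *\<^sub>C x + w *\<^sub>C x"
    and scaleC_scaleC: "z *\<^sub>C w *\<^sub>C x = (z * w) *\<^sub>C x"
    and scaleC_one: "1 *\<^sub>C x = x"

lemma vector_space_scaleC:
  "vector_space (scaleC :: complex \<Rightarrow> 'a::complex_vector \<Rightarrow> 'a)"
  by unfold_locales (simp_all add: scaleC_add_right scaleC_add_left scaleC_scaleC scaleC_one)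

instantiation complex :: complex_vector
begin
definition "scaleC z w = z * w" for w :: complex
instance by standard (simp_all add: scaleC_complex_def algebra_simps)
end

text \<open>The inner product is linear in the second slot, hence antilinear in the first.\<close>

class complex_inner = complex_vector + real_normed_vector +
  fixes cinner :: "'a \<Rightarrow> 'a \<Rightarrow> complex"
  assumes scaleR_scaleC: "scaleR r x = complex_of_real r *\<^sub>C x"
    and cinner_commute: "cinner x y = cnj (cinner y x)"
    and cinner_add_right: "cinner x (y + w) = cinner x y + cinner x w"
    and cinner_scaleC_right: "cinner x (z *\<^sub>C y) = z * cinner x y"
    and cinner_ge_zero: "0 \<le> Re (cinner x x)"
    and cinner_eq_zero_iff: "cinner x x = 0 \<longleftrightarrow> x = 0"
    and norm_eq_sqrt_cinner: "norm x = sqrt (Re (cinner x x))"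

class chilbert_space = complex_inner + complete_space

instantiation complex :: chilbert_space
begin
definition "cinner z w = cnj z * w" for z w :: complex
instance
  by standard (auto simp: scaleC_complex_def cinner_complex_def scaleR_conv_of_real
      algebra_simps cmod_def power2_eq_square)
end

definition symplectic_form :: "'v::complex_inner \<Rightarrow> 'v \<Rightarrow> real"  (\<open>\<Omega>\<close>)
  where "\<Omega> x y = Im (cinner x y)"


section \<open>The symmetric algebra\<close>

text \<open>
  The free commutative complex algebra on the underlying set of \<open>V\<close> consists of the polynomials
  with one indeterminate \<open>gen v\<close> for each vector \<open>v\<close>; a monomial is a finite multiset of vectors.
  The symmetric algebra is its quotient by the ideal which forces \<open>v \<mapsto> gen v\<close> to be complex linear.
\<close>

type_synonym 'v free_alg = "'v multiset \<Rightarrow>\<^sub>0 complex"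

definition const :: "complex \<Rightarrow> 'v free_alg"
  where "const z = Poly_Mapping.single {#} z"

definition gen :: "'v \<Rightarrow> 'v free_alg"
  where "gen v = Poly_Mapping.single {#v#} 1"

definition linearity_relations :: "'v::complex_vector free_alg set"
  where "linearity_relations =
    {gen (v + w) - gen v - gen w | v w. True} \<union> {gen (z *\<^sub>C v) - const z * gen v | z v. True}"

definition linearity_ideal :: "'v::complex_vector free_alg set"
  where "linearity_ideal = module.span (*) linearity_relations"

definition sym_rel :: "'v::complex_vector free_alg \<Rightarrow> 'v free_alg \<Rightarrow> bool"
  where "sym_rel p q \<longleftrightarrow> p - q \<in> linearity_ideal"

lemma module_times: "module ((*) :: 'a::comm_ring_1 \<Rightarrow> 'a \<Rightarrow> 'a)"
  by unfold_locales (simp_all add: algebra_simps)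

lemma ideal_zero: "0 \<in> linearity_ideal"
  unfolding linearity_ideal_def by (rule module.span_zero[OF module_times])

lemma ideal_add: "p \<in> linearity_ideal \<Longrightarrow> q \<in> linearity_ideal \<Longrightarrow> p + q \<in> linearity_ideal"
  unfolding linearity_ideal_def by (rule module.span_add[OF module_times])

lemma ideal_neg: "p \<in> linearity_ideal \<Longrightarrow> - p \<in> linearity_ideal"
  unfolding linearity_ideal_def by (rule module.span_neg[OF module_times])

lemma ideal_mult: "p \<in> linearity_ideal \<Longrightarrow> q * p \<in> linearity_ideal"
  unfolding linearity_ideal_def by (rule module.span_scale[OF module_times])

lemma ideal_base: "p \<in> linearity_relations \<Longrightarrow> p \<in> linearity_ideal"
  unfolding linearity_ideal_def by (rule module.span_base[OF module_times])

lemma equivp_sym_rel: "equivp sym_rel"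
proof (rule equivpI)
  show "reflp sym_rel" by (simp add: reflp_def sym_rel_def ideal_zero)
  show "symp sym_rel"
    unfolding symp_def sym_rel_def using ideal_neg by fastforce
  show "transp sym_rel"
    unfolding transp_def sym_rel_def using ideal_add by fastforce
qed

lemma sym_rel_eqI: "p = q \<Longrightarrow> sym_rel p q"
  by (simp add: sym_rel_def ideal_zero)

quotient_type (overloaded) 'v sym_alg = "'v::complex_vector free_alg" / sym_rel
  by (rule equivp_sym_rel)

lemma free_alg_induct [case_names monom add]:
  fixes p :: "'v free_alg"
  assumes "\<And>m z. P (Poly_Mapping.single m z)"
    and "\<And>p q. P p \<Longrightarrow> P q \<Longrightarrow> P (p + q)"
  shows "P p"
proof -
  have *: "P (\<Sum>m\<in>A. Poly_Mapping.single m (f m))" if "finite A" for A f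
    using that
  proof (induction A)
    case empty
    show ?case using assms(1)[of "{#}" 0] by simp
  qed (simp add: assms)
  have "p = (\<Sum>m\<in>Poly_Mapping.keys p. Poly_Mapping.single m (Poly_Mapping.lookup p m))"
    by (rule poly_mapping_eqI)
      (simp add: lookup_sum lookup_single when_def sum.delta in_keys_iff)
  with *[of "Poly_Mapping.keys p"] show ?thesis by (metis finite_keys)
qed

lemma lookup_mult_empty:
  fixes p q :: "'v free_alg"
  shows "Poly_Mapping.lookup (p * q) {#} = Poly_Mapping.lookup p {#} * Poly_Mapping.lookup q {#}"
proof (induction p rule: free_alg_induct)
  case (monom m z)
  show ?case
    by (induction q rule: free_alg_induct)
      (auto simp: mult_single lookup_single when_def lookup_add algebra_simps)
qed (simp add: lookup_add algebra_simps)

lemma lookup_ideal_empty: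
  assumes "p \<in> linearity_ideal"
  shows "Poly_Mapping.lookup p {#} = 0"
  using assms unfolding linearity_ideal_def
proof (induction rule: module.span_induct_alt[OF module_times, consumes 1])
  case (2 c x y)
  then show ?case
    by (auto simp: lookup_add lookup_mult_empty linearity_relations_def lookup_minus gen_def
        lookup_single)
qed simp

instantiation sym_alg :: (complex_vector) comm_ring_1
begin

lift_definition zero_sym_alg :: "'a sym_alg" is 0 .
lift_definition one_sym_alg :: "'a sym_alg" is 1 .
lift_definition plus_sym_alg :: "'a sym_alg \<Rightarrow> 'a sym_alg \<Rightarrow> 'a sym_alg" is "(+)"
proof -
  fix p p' q q' :: "'a free_alg"
  assume "sym_rel p p'" "sym_rel q q'"
  then have "(p - p') + (q - q') \<in> linearity_ideal"
    unfolding sym_rel_def by (rule ideal_add)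
  then show "sym_rel (p + q) (p' + q')"
    unfolding sym_rel_def by (simp add: algebra_simps)
qed
lift_definition uminus_sym_alg :: "'a sym_alg \<Rightarrow> 'a sym_alg" is uminus
proof -
  fix p q :: "'a free_alg"
  assume "sym_rel p q"
  then have "- (p - q) \<in> linearity_ideal"
    unfolding sym_rel_def by (rule ideal_neg)
  then show "sym_rel (- p) (- q)"
    unfolding sym_rel_def by simp
qed
lift_definition minus_sym_alg :: "'a sym_alg \<Rightarrow> 'a sym_alg \<Rightarrow> 'a sym_alg" is "(-)"
proof -
  fix p p' q q' :: "'a free_alg"
  assume "sym_rel p p'" "sym_rel q q'"
  then have "(p - p') + - (q - q') \<in> linearity_ideal"
    unfolding sym_rel_def by (intro ideal_add ideal_neg)
  then show "sym_rel (p - q) (p' - q')"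
    unfolding sym_rel_def by (simp add: algebra_simps)
qed
lift_definition times_sym_alg :: "'a sym_alg \<Rightarrow> 'a sym_alg \<Rightarrow> 'a sym_alg" is "(*)"
proof -
  fix p p' q q' :: "'a free_alg"
  assume "sym_rel p p'" "sym_rel q q'"
  then have "q * (p - p') + p' * (q - q') \<in> linearity_ideal"
    unfolding sym_rel_def by (intro ideal_add ideal_mult)
  then show "sym_rel (p * q) (p' * q')"
    unfolding sym_rel_def by (simp add: algebra_simps)
qed

instance
proof
  have "(1 :: 'a free_alg) \<notin> linearity_ideal"
    using lookup_ideal_empty[of "1 :: 'a free_alg"] by (auto simp: lookup_one)
  then have "\<not> sym_rel (0 :: 'a free_alg) 1"
    using ideal_neg[of "- 1 :: 'a free_alg"] by (auto simp: sym_rel_def)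
  then show "(0::'a sym_alg) \<noteq> 1"
    by transfer
qed (transfer; rule sym_rel_eqI; simp add: algebra_simps)+

end

instantiation sym_alg :: (complex_vector) complex_vector
begin

lift_definition scaleC_sym_alg :: "complex \<Rightarrow> 'a sym_alg \<Rightarrow> 'a sym_alg" is "\<lambda>z p. const z * p"
  unfolding sym_rel_def by (simp add: ideal_mult flip: right_diff_distrib)

instance
proof
  fix z w :: complex and p q :: "'a sym_alg"
  show "z *\<^sub>C (p + q) = z *\<^sub>C p + z *\<^sub>C q"
    by (transfer, rule sym_rel_eqI, simp add: algebra_simps)
  show "(z + w) *\<^sub>C p = z *\<^sub>C p + w *\<^sub>C p"
    by (transfer, rule sym_rel_eqI, simp add: algebra_simps const_def single_add)
  show "z *\<^sub>C w *\<^sub>C p = (z * w) *\<^sub>C p"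
    by (transfer, rule sym_rel_eqI, simp add: mult.assoc[symmetric] const_def mult_single)
  show "1 *\<^sub>C p = p"
    by (transfer, rule sym_rel_eqI, simp add: const_def flip: zero_multiset_def)
qed

end

text \<open>The canonical map from \<open>V\<close> to the symmetric algebra, along which \<open>V\<close> is regarded as a
  subspace of it.\<close>

lift_definition sym_of :: "'v::complex_vector \<Rightarrow> 'v sym_alg" is gen .

lemma sym_of_add: "sym_of (v + w) = sym_of v + sym_of w"
proof transfer
  fix v w :: 'a
  have "gen (v + w) - gen v - gen w \<in> linearity_ideal"
    by (rule ideal_base) (unfold linearity_relations_def, blast)
  then show "sym_rel (gen (v + w)) (gen v + gen w)"
    by (simp add: sym_rel_def diff_diff_eq)
qed

lemma sym_of_scaleC: "sym_of (z *\<^sub>C v) = z *\<^sub>C sym_of v"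
proof transfer
  fix z and v :: 'a
  show "sym_rel (gen (z *\<^sub>C v)) (const z * gen v)"
    unfolding sym_rel_def by (rule ideal_base) (unfold linearity_relations_def, blast)
qed

lemma scaleC_mult_left: "(z *\<^sub>C p) * q = z *\<^sub>C (p * q)" for p q :: "'v::complex_vector sym_alg"
  by (transfer, rule sym_rel_eqI, simp add: mult.assoc)

lemma scaleC_mult_right: "p * (z *\<^sub>C q) = z *\<^sub>C (p * q)" for p q :: "'v::complex_vector sym_alg"
  by (metis scaleC_mult_left mult.commute)

lemma sym_alg_induct [case_names one gen add scale]:
  fixes p :: "'v::complex_vector sym_alg"
  assumes "P 1" and "\<And>v p. P p \<Longrightarrow> P (sym_of v * p)"
    and "\<And>p q. P p \<Longrightarrow> P q \<Longrightarrow> P (p + q)" and "\<And>z p. P p \<Longrightarrow> P (z *\<^sub>C p)"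
  shows "P p"
proof -
  have 1: "P (abs_sym_alg (Poly_Mapping.single m 1))" for m
  proof (induction m)
    case empty
    have "abs_sym_alg (Poly_Mapping.single {#} 1) = (1 :: 'v sym_alg)"
      by (simp add: one_sym_alg_def flip: zero_multiset_def)
    with assms(1) show ?case by simp
  next
    case (add v m)
    have "abs_sym_alg (Poly_Mapping.single (add_mset v m) 1) =
        sym_of v * abs_sym_alg (Poly_Mapping.single m 1)"
      by (simp add: sym_of.abs_eq times_sym_alg.abs_eq gen_def mult_single)
    with assms(2) add show ?case by simp
  qed
  have 2: "P (abs_sym_alg r)" for r
  proof (induction r rule: free_alg_induct)
    case (monom m z)
    have "abs_sym_alg (Poly_Mapping.single m z) = z *\<^sub>C abs_sym_alg (Poly_Mapping.single m 1)"
      by (simp add: scaleC_sym_alg.abs_eq const_def mult_single)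
    with assms(4) 1 show ?case by simp
  next
    case (add p q)
    then show ?case using assms(3) by (simp flip: plus_sym_alg.abs_eq)
  qed
  show ?thesis using 2 by (rule sym_alg.abs_induct)
qed


section \<open>Creators and annihilators on the symmetric algebra\<close>

definition creator :: "'v::complex_inner \<Rightarrow> 'v sym_alg \<Rightarrow> 'v sym_alg"
  where "creator v \<psi> = sym_of v * \<psi>"

definition is_annihilator :: "'v::complex_inner \<Rightarrow> ('v sym_alg \<Rightarrow> 'v sym_alg) \<Rightarrow> bool"
  where "is_annihilator v D \<longleftrightarrow>
    Vector_Spaces.linear scaleC scaleC D \<and>
    (\<forall>\<phi> \<psi>. D (\<phi> * \<psi>) = D \<phi> * \<psi> + \<phi> * D \<psi>) \<and>
    D 1 = 0 \<and>
    (\<forall>w. D (sym_of w) = cinner v w *\<^sub>C 1)"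

definition annihilator :: "'v::complex_inner \<Rightarrow> 'v sym_alg \<Rightarrow> 'v sym_alg"
  where "annihilator v = (THE D. is_annihilator v D)"

text \<open>The rest of this section shows that the defining description of \<^const>\<open>annihilator\<close>
  has exactly one solution, obtained from a derivation of the free algebra.\<close>

definition monom_deriv :: "'v::complex_inner \<Rightarrow> 'v multiset \<Rightarrow> 'v free_alg"
  where "monom_deriv v m = (\<Sum>w\<in>#m. Poly_Mapping.single (m - {#w#}) (cinner v w))"

definition free_deriv :: "'v::complex_inner \<Rightarrow> 'v free_alg \<Rightarrow> 'v free_alg"
  where "free_deriv v p =
    (\<Sum>m\<in>Poly_Mapping.keys p. const (Poly_Mapping.lookup p m) * monom_deriv v m)"

lemma const_simps: "const 0 = 0" "const (z + w) = const z + const w" "const (z * w) = const z * const w"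
  by (simp_all add: const_def single_add mult_single)

lemma free_deriv_add: "free_deriv v (p + q) = free_deriv v p + free_deriv v q"
  unfolding free_deriv_def
  by (rule setsum_keys_plus_distrib) (simp_all add: const_simps algebra_simps)

lemma free_deriv_single: "free_deriv v (Poly_Mapping.single m z) = const z * monom_deriv v m"
  by (cases "z = 0") (simp_all add: free_deriv_def const_simps)

lemma const_mult_single: "const z * Poly_Mapping.single m w = Poly_Mapping.single m (z * w)"
  by (simp add: const_def mult_single)

lemma monom_deriv_half:
  "(\<Sum>w\<in>#m. Poly_Mapping.single (m + n - {#w#}) (cinner v w)) =
    monom_deriv v m * Poly_Mapping.single n 1"
proof -
  have "(\<Sum>w\<in>#m. Poly_Mapping.single (m + n - {#w#}) (cinner v w)) =
      (\<Sum>w\<in>#m. Poly_Mapping.single (m - {#w#}) (cinner v w) * Poly_Mapping.single n 1)"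
    by (rule arg_cong[where f = sum_mset], rule image_mset_cong)
      (simp add: mult_single)
  then show ?thesis by (simp add: monom_deriv_def sum_mset_distrib_right)
qed

lemma monom_deriv_add: "monom_deriv v (m + n) =
    monom_deriv v m * Poly_Mapping.single n 1 + Poly_Mapping.single m 1 * monom_deriv v n"
  using monom_deriv_half[of m n v] monom_deriv_half[of n m v]
  by (simp add: monom_deriv_def[of v "m + n"] add.commute[of n m] mult.commute)

lemma free_deriv_mult: "free_deriv v (p * q) = free_deriv v p * q + p * free_deriv v q"
proof (induction p rule: free_alg_induct)
  case (monom m z)
  show ?case
  proof (induction q rule: free_alg_induct)
    case (monom n w)
    have s: "Poly_Mapping.single k u = const u * Poly_Mapping.single k 1" for k :: "'a multiset" and u
      by (simp add: const_mult_single)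
    show ?case
      unfolding mult_single free_deriv_single monom_deriv_add
      by (subst (3) s, subst (4) s) (simp add: const_simps algebra_simps)
  qed (simp add: free_deriv_add algebra_simps)
qed (simp add: free_deriv_add algebra_simps)

lemma free_deriv_const: "free_deriv v (const z) = 0"
  by (simp add: const_def free_deriv_single monom_deriv_def)

lemma free_deriv_gen: "free_deriv v (gen w) = const (cinner v w)"
  by (simp add: gen_def free_deriv_single monom_deriv_def const_def mult_single)

lemma free_deriv_diff: "free_deriv v (p - q) = free_deriv v p - free_deriv v q"
  by (metis add_diff_cancel_right' diff_add_cancel free_deriv_add)

lemma free_deriv_relation: "p \<in> linearity_relations \<Longrightarrow> free_deriv v p = 0"
  by (auto simp: linearity_relations_def free_deriv_diff free_deriv_gen free_deriv_mult
      free_deriv_const cinner_add_right cinner_scaleC_right const_simps)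

lemma free_deriv_ideal:
  assumes "p \<in> linearity_ideal"
  shows "free_deriv v p \<in> linearity_ideal"
  using assms unfolding linearity_ideal_def
proof (induction rule: module.span_induct_alt[OF module_times, consumes 1])
  case 1
  have "free_deriv v 0 = 0" by (simp add: free_deriv_def)
  then show ?case using ideal_zero by (simp add: linearity_ideal_def)
next
  case (2 c x y)
  then have "free_deriv v y \<in> linearity_ideal"
    by (simp add: linearity_ideal_def)
  moreover have "x \<in> linearity_ideal"
    using 2 by (blast intro: ideal_base)
  ultimately have "free_deriv v c * x + free_deriv v y \<in> linearity_ideal"
    by (intro ideal_add ideal_mult)
  then show ?case
    using 2 by (simp add: free_deriv_add free_deriv_mult free_deriv_relation linearity_ideal_def)
qed

lift_definition sym_deriv :: "'v::complex_inner \<Rightarrow> 'v sym_alg \<Rightarrow> 'v sym_alg" is free_deriv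
  unfolding sym_rel_def using free_deriv_ideal by (metis free_deriv_diff)

lemma linear_scaleC_iff:
  "Vector_Spaces.linear scaleC scaleC D \<longleftrightarrow>
    (\<forall>p q. D (p + q) = D p + D q) \<and> (\<forall>z p. D (z *\<^sub>C p) = z *\<^sub>C D p)"
  for D :: "'a::complex_vector \<Rightarrow> 'b::complex_vector"
  using vector_space_scaleC[where 'a = 'a] vector_space_scaleC[where 'a = 'b]
  by (auto simp: Vector_Spaces.linear_def module_hom_def module_hom_axioms_def module_iff_vector_space)

lemma is_annihilator_sym_deriv: "is_annihilator v (sym_deriv v)"
  unfolding is_annihilator_def linear_scaleC_iff
proof (intro conjI allI)
  fix \<phi> \<psi> :: "'a sym_alg" and z w
  show "sym_deriv v (\<phi> + \<psi>) = sym_deriv v \<phi> + sym_deriv v \<psi>"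
    by (transfer, rule sym_rel_eqI, simp add: free_deriv_add)
  show "sym_deriv v (z *\<^sub>C \<phi>) = z *\<^sub>C sym_deriv v \<phi>"
    by (transfer, rule sym_rel_eqI, simp add: free_deriv_mult free_deriv_const)
  show "sym_deriv v (\<phi> * \<psi>) = sym_deriv v \<phi> * \<psi> + \<phi> * sym_deriv v \<psi>"
    by (transfer, rule sym_rel_eqI, simp add: free_deriv_mult)
  have "(1 :: 'a free_alg) = const 1"
    by (simp add: const_def flip: zero_multiset_def)
  then show "sym_deriv v 1 = 0"
    using free_deriv_const[of v 1] by (simp add: sym_deriv.abs_eq one_sym_alg_def zero_sym_alg_def)
  show "sym_deriv v (sym_of w) = cinner v w *\<^sub>C 1"
    by (transfer, rule sym_rel_eqI, simp add: free_deriv_gen)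
qed

lemma is_annihilator_unique:
  assumes "is_annihilator v D" "is_annihilator v D'"
  shows "D = D'"
proof
  fix p
  show "D p = D' p"
    using assms unfolding is_annihilator_def linear_scaleC_iff
    by (induction p rule: sym_alg_induct) simp_all
qed

lemma is_annihilator_annihilator: "is_annihilator v (annihilator v)"
  unfolding annihilator_def
  by (rule theI[where P = "is_annihilator v", OF is_annihilator_sym_deriv])
    (rule is_annihilator_unique[OF _ is_annihilator_sym_deriv])

lemma annihilator_add: "annihilator v (\<phi> + \<psi>) = annihilator v \<phi> + annihilator v \<psi>"
  and annihilator_scaleC: "annihilator v (z *\<^sub>C \<phi>) = z *\<^sub>C annihilator v \<phi>"
  using is_annihilator_annihilator[of v]
  by (simp_all add: is_annihilator_def linear_scaleC_iff)


section \<open>The antidual of the symmetric algebra\<close>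

definition antilinear_functional :: "('a::complex_vector \<Rightarrow> complex) \<Rightarrow> bool"
  where "antilinear_functional \<Phi> \<longleftrightarrow>
    (\<forall>\<phi> \<psi>. \<Phi> (\<phi> + \<psi>) = \<Phi> \<phi> + \<Phi> \<psi>) \<and> (\<forall>z \<psi>. \<Phi> (z *\<^sub>C \<psi>) = cnj z * \<Phi> \<psi>)"

typedef (overloaded) 'v sym_antidual =
  "{\<Phi> :: 'v::complex_vector sym_alg \<Rightarrow> complex. antilinear_functional \<Phi>}"
  morphisms antidual_apply Abs_sym_antidual
  by (intro exI[of _ "\<lambda>_. 0"]) (simp add: antilinear_functional_def)

setup_lifting type_definition_sym_antidual

instantiation sym_antidual :: (complex_vector) complex_vector
begin

lift_definition zero_sym_antidual :: "'a sym_antidual" is "\<lambda>_. 0"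
  by (simp add: antilinear_functional_def)
lift_definition plus_sym_antidual :: "'a sym_antidual \<Rightarrow> 'a sym_antidual \<Rightarrow> 'a sym_antidual"
  is "\<lambda>\<Phi> \<Psi> \<psi>. \<Phi> \<psi> + \<Psi> \<psi>"
  by (simp add: antilinear_functional_def algebra_simps)
lift_definition uminus_sym_antidual :: "'a sym_antidual \<Rightarrow> 'a sym_antidual"
  is "\<lambda>\<Phi> \<psi>. - \<Phi> \<psi>"
  by (simp add: antilinear_functional_def)
lift_definition minus_sym_antidual :: "'a sym_antidual \<Rightarrow> 'a sym_antidual \<Rightarrow> 'a sym_antidual"
  is "\<lambda>\<Phi> \<Psi> \<psi>. \<Phi> \<psi> - \<Psi> \<psi>"
  by (simp add: antilinear_functional_def algebra_simps)
lift_definition scaleC_sym_antidual :: "complex \<Rightarrow> 'a sym_antidual \<Rightarrow> 'a sym_antidual"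
  is "\<lambda>z \<Phi> \<psi>. z * \<Phi> \<psi>"
  by (simp add: antilinear_functional_def algebra_simps)

instance
  by standard (transfer; simp add: fun_eq_iff algebra_simps)+

end

lift_definition creator_antidual :: "'v::complex_inner \<Rightarrow> 'v sym_antidual \<Rightarrow> 'v sym_antidual"
  is "\<lambda>v \<Phi> \<psi>. \<Phi> (annihilator v \<psi>)"
  by (simp add: antilinear_functional_def annihilator_add annihilator_scaleC)

lift_definition annihilator_antidual :: "'v::complex_inner \<Rightarrow> 'v sym_antidual \<Rightarrow> 'v sym_antidual"
  is "\<lambda>v \<Phi> \<psi>. \<Phi> (creator v \<psi>)"
  by (simp add: antilinear_functional_def creator_def distrib_left scaleC_mult_right)


section \<open>Field operators and commutators\<close>

definition field_operator :: "'v::complex_inner \<Rightarrow> 'v sym_alg \<Rightarrow> 'v sym_alg"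
  where "field_operator v \<psi> = complex_of_real (1 / sqrt 2) *\<^sub>C (creator v \<psi> + annihilator v \<psi>)"

definition field_operator_antidual :: "'v::complex_inner \<Rightarrow> 'v sym_antidual \<Rightarrow> 'v sym_antidual"
  where "field_operator_antidual v \<Phi> =
    complex_of_real (1 / sqrt 2) *\<^sub>C (creator_antidual v \<Phi> + annihilator_antidual v \<Phi>)"

definition commutator :: "('a::ab_group_add \<Rightarrow> 'a) \<Rightarrow> ('a \<Rightarrow> 'a) \<Rightarrow> 'a \<Rightarrow> 'a"
  where "commutator A B \<psi> = A (B \<psi>) - B (A \<psi>)"

end

theory Submission
  imports Defs
begin

text \<open>
  On the symmetric algebra the canonical commutation relations hold: creators commute because the
  algebra is commutative, annihilators commute because contracting a product of vectors with \<open>x\<close> and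
  with \<open>y\<close> gives the same sum in either order, and \<open>[a(x), c(y)] = \<langle>x|y\<rangle> I\<close> is the Leibniz rule. Expanding
  \<open>[\<pi>(x), \<pi>(y)]\<close> therefore leaves \<open>(\<langle>x|y\<rangle> - \<langle>y|x\<rangle>) / 2\<close>, which is \<open>i \<Omega>(x, y)\<close> by Hermitian
  symmetry.

  The antidual needs no second computation. There the roles of \<open>c(v)\<close> and \<open>a(v)\<close> are exchanged, so
  their sum is simply the transpose: \<open>(\<pi>(v) \<Phi>)(\<psi>) = \<Phi> (\<pi>(v) \<psi>)\<close>, the scalar \<open>1 / sqrt 2\<close> being
  real. Transposition reverses products, so \<open>[\<pi>(x), \<pi>(y)]\<close> on the antidual is the transpose of
  \<open>[\<pi>(y), \<pi>(x)] = - i \<Omega>(x, y) I\<close>. Since functionals are antilinear, this scalar comes out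
  conjugated, and the sign is restored.
\<close>

lemmas scaleC_diff_right = module.scale_right_diff_distrib[OF vector_space_scaleC[folded module_iff_vector_space]]
  and scaleC_diff_left = module.scale_left_diff_distrib[OF vector_space_scaleC[folded module_iff_vector_space]]

lemma annihilator_mult:
  "annihilator v (\<phi> * \<psi>) = annihilator v \<phi> * \<psi> + \<phi> * annihilator v \<psi>"
  and annihilator_one: "annihilator v 1 = 0"
  and annihilator_sym_of: "annihilator v (sym_of w) = cinner v w *\<^sub>C 1"
  using is_annihilator_annihilator[of v] by (simp_all add: is_annihilator_def)

lemma annihilator_zero: "annihilator v 0 = 0"
  using annihilator_add[of v 0 0] by simp

lemma creator_add: "creator v (\<phi> + \<psi>) = creator v \<phi> + creator v \<psi>"
  and creator_scaleC: "creator v (z *\<^sub>C \<phi>) = z *\<^sub>C creator v \<phi>"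
  by (simp_all add: creator_def distrib_left scaleC_mult_right)

lemma creators_commute: "creator x (creator y \<psi>) = creator y (creator x \<psi>)"
  by (simp add: creator_def mult.left_commute)

lemma annihilator_creator:
  "annihilator x (creator y \<psi>) = cinner x y *\<^sub>C \<psi> + creator y (annihilator x \<psi>)"
  by (simp add: creator_def annihilator_mult annihilator_sym_of scaleC_mult_left)

text \<open>Moving both annihilators past a creator \<open>c(v)\<close> produces two contraction terms, and
  exchanging \<open>x\<close> and \<open>y\<close> merely exchanges these. So the property passes from \<open>\<psi>\<close> to
  \<open>v \<psi>\<close>, starting from the vacuum \<open>1\<close>.\<close>

lemma annihilators_commute: "annihilator x (annihilator y \<psi>) = annihilator y (annihilator x \<psi>)"
proof (induction \<psi> rule: sym_alg_induct)
  case one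
  then show ?case
    by (simp add: annihilator_one annihilator_zero)
next
  case (gen v p)
  then show ?case
    by (simp add: annihilator_creator annihilator_add annihilator_scaleC add_ac
        flip: creator_def)
qed (simp_all add: annihilator_add annihilator_scaleC)

theorem field_operator_commutator:
  "commutator (field_operator x) (field_operator y) \<psi> = (\<i> * complex_of_real (\<Omega> x y)) *\<^sub>C \<psi>"
proof -
  let ?s = "complex_of_real (1 / sqrt 2)"
  \<comment> \<open>With the creator moved to the left of \<open>a(u) c(v)\<close>, the contraction \<open>cinner u v\<close> is the only
    part of the product that is not symmetric in \<open>u\<close> and \<open>v\<close>.\<close>
  have prod: "field_operator u (field_operator v \<psi>) =
      (?s * ?s) *\<^sub>C (creator u (creator v \<psi>) + creator u (annihilator v \<psi>) +
        (cinner u v *\<^sub>C \<psi> + creator v (annihilator u \<psi>)) + annihilator u (annihilator v \<psi>))" for u v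
    by (simp add: field_operator_def creator_add creator_scaleC annihilator_add annihilator_scaleC
        annihilator_creator scaleC_add_right scaleC_scaleC add_ac)
  have "commutator (field_operator x) (field_operator y) \<psi> =
      (?s * ?s) *\<^sub>C ((cinner x y - cinner y x) *\<^sub>C \<psi>)"
    unfolding commutator_def prod scaleC_diff_right[symmetric] scaleC_diff_left
    by (simp add: creators_commute[of y x] annihilators_commute[of y x])
  moreover have "?s * ?s * (cinner x y - cinner y x) = \<i> * complex_of_real (\<Omega> x y)"
  proof -
    have "?s * ?s = 1 / 2"
      by (simp flip: of_real_mult)
    moreover have "cinner x y - cinner y x = 2 * \<i> * complex_of_real (\<Omega> x y)"
      by (subst cinner_commute[of y x]) (simp add: complex_eq_iff symplectic_form_def)
    ultimately show ?thesis
      by simp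
  qed
  ultimately show ?thesis
    by (simp only: scaleC_scaleC)
qed

lemma antidual_apply_add: "antidual_apply \<Phi> (\<phi> + \<psi>) = antidual_apply \<Phi> \<phi> + antidual_apply \<Phi> \<psi>"
  and antidual_apply_scaleC: "antidual_apply \<Phi> (z *\<^sub>C \<psi>) = cnj z * antidual_apply \<Phi> \<psi>"
  using antidual_apply[of \<Phi>] by (simp_all add: antilinear_functional_def)

lemma antidual_apply_diff:
  "antidual_apply \<Phi> (\<phi> - \<psi>) = antidual_apply \<Phi> \<phi> - antidual_apply \<Phi> \<psi>"
  by (metis add_diff_cancel_right' antidual_apply_add diff_add_cancel)

text \<open>Being the transpose of \<open>\<pi>(v)\<close> uses that \<open>1 / sqrt 2\<close> is real: it leaves the antilinear
  functional conjugated.\<close>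

lemma field_operator_antidual_apply:
  "antidual_apply (field_operator_antidual v \<Phi>) \<psi> = antidual_apply \<Phi> (field_operator v \<psi>)"
  by (simp add: field_operator_antidual_def field_operator_def scaleC_sym_antidual.rep_eq
      plus_sym_antidual.rep_eq creator_antidual.rep_eq annihilator_antidual.rep_eq
      antidual_apply_add antidual_apply_scaleC add.commute)

lemma symplectic_form_skew: "\<Omega> y x = - \<Omega> x y"
  unfolding symplectic_form_def by (subst cinner_commute) simp

theorem field_operator_antidual_commutator:
  "commutator (field_operator_antidual x) (field_operator_antidual y) \<Phi> =
    (\<i> * complex_of_real (\<Omega> x y)) *\<^sub>C \<Phi>"
proof -
  have "antidual_apply (commutator (field_operator_antidual x) (field_operator_antidual y) \<Phi>) \<psi> =
      antidual_apply ((\<i> * complex_of_real (\<Omega> x y)) *\<^sub>C \<Phi>) \<psi>" for \<psi>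
  proof -
    have "antidual_apply (commutator (field_operator_antidual x) (field_operator_antidual y) \<Phi>) \<psi> =
        antidual_apply \<Phi> (commutator (field_operator y) (field_operator x) \<psi>)"
      by (simp add: commutator_def minus_sym_antidual.rep_eq field_operator_antidual_apply
          antidual_apply_diff)
    also have "\<dots> = cnj (\<i> * complex_of_real (\<Omega> y x)) * antidual_apply \<Phi> \<psi>"
      by (simp only: field_operator_commutator antidual_apply_scaleC)
    also have "\<dots> = antidual_apply ((\<i> * complex_of_real (\<Omega> x y)) *\<^sub>C \<Phi>) \<psi>"
      by (simp add: symplectic_form_skew[of y x] scaleC_sym_antidual.rep_eq)
    finally show ?thesis .
  qed
  then show ?thesis
    by (simp add: fun_eq_iff flip: antidual_apply_inject)
qed

theorem theorem3p5:
  fixes x y :: "'v::chilbert_space"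
  shows "commutator (field_operator x) (field_operator y) =
           (\<lambda>\<psi> :: 'v sym_alg. (\<i> * complex_of_real (\<Omega> x y)) *\<^sub>C \<psi>)
       \<and> commutator (field_operator_antidual x) (field_operator_antidual y) =
           (\<lambda>\<Phi> :: 'v sym_antidual. (\<i> * complex_of_real (\<Omega> x y)) *\<^sub>C \<Phi>)"
  by (simp add: fun_eq_iff field_operator_commutator field_operator_antidual_commutator)

end
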